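(* Over a field of characteristic $0$, every multilinear polynomial identity of degree $3$ satisfied by the special commutator $[x,y,z]=xyz-yxz$ and the special translator $\langle x,y,z\rangle=xyz-yzx$ in every associative triple system follows from the identities \begin{align*} &[x,y,z]+[y,x,z]=0,\\ &\langle x,y,z\rangle+\langle y,z,x\rangle+\langle z,x,y\rangle=0,\\ &[x,y,z]+[z,y,x]=\langle x,y,z\rangle+\langle z,y,x\rangle. \end{align*}
   Context: An associative triple system is a vector space $A$ with a trilinear operation $(x,y,z)\mapsto xyz$ satisfying $((vwx)yz)=(v(wxy)z)=(vw(xyz))$. A multilinear identity of degree 3 in the two operations is a linear combination of the 12 monomials obtained by permuting $x,y,z$ in $[x,y,z]$ and $\langle x,y,z\rangle$, where the two operations are regarded as free trilinear operations with no symmetry; it is satisfied if it becomes $0$ when the operations are replaced by the special commutator and special translator in every associative triple system. In degree 3, an identity follows from given identities if it is a linear combination of the identities obtained from them by permuting the variables. *)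

theory Defs
  imports Complex_Main "HOL-Library.Poly_Mapping"
begin

text \<open>
  The carrier \<open>A\<close> is a subspace of an ambient vector space on the type \<open>'v\<close>, and the
  product only matters on \<open>A\<close>.
\<close>

locale assoc_triple_system = vector_space scale
  for scale :: "'k::field \<Rightarrow> 'v::ab_group_add \<Rightarrow> 'v" +
  fixes A :: "'v set"
    and prd :: "'v \<Rightarrow> 'v \<Rightarrow> 'v \<Rightarrow> 'v"
  assumes subspace_carrier: "subspace A"
    and closed: "\<lbrakk>x \<in> A; y \<in> A; z \<in> A\<rbrakk> \<Longrightarrow> prd x y z \<in> A"
    and add_1: "\<lbrakk>x \<in> A; x' \<in> A; y \<in> A; z \<in> A\<rbrakk> \<Longrightarrow> prd (x + x') y z = prd x y z + prd x' y z"
    and add_2: "\<lbrakk>x \<in> A; y \<in> A; y' \<in> A; z \<in> A\<rbrakk> \<Longrightarrow> prd x (y + y') z = prd x y z + prd x y' z"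
    and add_3: "\<lbrakk>x \<in> A; y \<in> A; z \<in> A; z' \<in> A\<rbrakk> \<Longrightarrow> prd x y (z + z') = prd x y z + prd x y z'"
    and scale_1: "\<lbrakk>x \<in> A; y \<in> A; z \<in> A\<rbrakk> \<Longrightarrow> prd (scale c x) y z = scale c (prd x y z)"
    and scale_2: "\<lbrakk>x \<in> A; y \<in> A; z \<in> A\<rbrakk> \<Longrightarrow> prd x (scale c y) z = scale c (prd x y z)"
    and scale_3: "\<lbrakk>x \<in> A; y \<in> A; z \<in> A\<rbrakk> \<Longrightarrow> prd x y (scale c z) = scale c (prd x y z)"
    and assoc_12: "\<lbrakk>v \<in> A; w \<in> A; x \<in> A; y \<in> A; z \<in> A\<rbrakk>
      \<Longrightarrow> prd (prd v w x) y z = prd v (prd w x y) z"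
    and assoc_23: "\<lbrakk>v \<in> A; w \<in> A; x \<in> A; y \<in> A; z \<in> A\<rbrakk>
      \<Longrightarrow> prd v (prd w x y) z = prd v w (prd x y z)"

definition special_commutator :: "('v::ab_group_add \<Rightarrow> 'v \<Rightarrow> 'v \<Rightarrow> 'v) \<Rightarrow> 'v \<Rightarrow> 'v \<Rightarrow> 'v \<Rightarrow> 'v"
  where "special_commutator prd x y z = prd x y z - prd y x z"

definition special_translator :: "('v::ab_group_add \<Rightarrow> 'v \<Rightarrow> 'v \<Rightarrow> 'v) \<Rightarrow> 'v \<Rightarrow> 'v \<Rightarrow> 'v \<Rightarrow> 'v"
  where "special_translator prd x y z = prd x y z - prd y z x"

datatype var = X | Y | Z

text \<open>\<open>Comm u v w\<close> and \<open>Transl u v w\<close> are the formal monomials $[u,v,w]$ and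
  $\langle u,v,w\rangle$ in two free trilinear operations.\<close>

datatype 'x monom3 = Comm 'x 'x 'x | Transl 'x 'x 'x

fun multilinear_monom :: "var monom3 \<Rightarrow> bool" where
  "multilinear_monom (Comm u v w) \<longleftrightarrow> distinct [u, v, w]"
| "multilinear_monom (Transl u v w) \<longleftrightarrow> distinct [u, v, w]"

type_synonym 'k poly3 = "var monom3 \<Rightarrow>\<^sub>0 'k"

definition multilinear :: "'k::zero poly3 \<Rightarrow> bool"
  where "multilinear p \<longleftrightarrow> (\<forall>m \<in> Poly_Mapping.keys p. multilinear_monom m)"

definition scale_poly3 :: "'k::field \<Rightarrow> 'k poly3 \<Rightarrow> 'k poly3"
  where "scale_poly3 c p = Poly_Mapping.map (\<lambda>a. c * a) p"

lemma lookup_scale_poly3: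
  "Poly_Mapping.lookup (scale_poly3 c p) m = c * Poly_Mapping.lookup p m"
  by (simp add: scale_poly3_def map.rep_eq when_def)

lemma vector_space_scale_poly3: "vector_space scale_poly3"
  by unfold_locales
    (auto simp: poly_mapping_eq_iff fun_eq_iff lookup_scale_poly3 lookup_add algebra_simps)

definition permute_vars :: "(var \<Rightarrow> var) \<Rightarrow> 'k::field poly3 \<Rightarrow> 'k poly3"
  where "permute_vars \<sigma> p =
    (\<Sum>m \<in> Poly_Mapping.keys p. Poly_Mapping.single (map_monom3 \<sigma> m) (Poly_Mapping.lookup p m))"

definition follows_from :: "'k::field poly3 \<Rightarrow> 'k poly3 set \<Rightarrow> bool"
  where "follows_from p I \<longleftrightarrow>
    p \<in> module.span scale_poly3 {permute_vars \<sigma> q | \<sigma> q. bij \<sigma> \<and> q \<in> I}"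

fun eval_monom3 :: "('v::ab_group_add \<Rightarrow> 'v \<Rightarrow> 'v \<Rightarrow> 'v) \<Rightarrow> (var \<Rightarrow> 'v) \<Rightarrow> var monom3 \<Rightarrow> 'v" where
  "eval_monom3 prd \<rho> (Comm u v w) = special_commutator prd (\<rho> u) (\<rho> v) (\<rho> w)"
| "eval_monom3 prd \<rho> (Transl u v w) = special_translator prd (\<rho> u) (\<rho> v) (\<rho> w)"

definition eval_poly3 ::
  "('k::field \<Rightarrow> 'v::ab_group_add \<Rightarrow> 'v) \<Rightarrow> ('v \<Rightarrow> 'v \<Rightarrow> 'v \<Rightarrow> 'v) \<Rightarrow> (var \<Rightarrow> 'v) \<Rightarrow> 'k poly3 \<Rightarrow> 'v"
  where "eval_poly3 scale prd \<rho> p =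
    (\<Sum>m \<in> Poly_Mapping.keys p. scale (Poly_Mapping.lookup p m) (eval_monom3 prd \<rho> m))"

definition satisfied_in ::
  "('k::field \<Rightarrow> 'v::ab_group_add \<Rightarrow> 'v) \<Rightarrow> 'v set \<Rightarrow> ('v \<Rightarrow> 'v \<Rightarrow> 'v \<Rightarrow> 'v) \<Rightarrow> 'k poly3 \<Rightarrow> bool"
  where "satisfied_in scale A prd p \<longleftrightarrow>
    (\<forall>\<rho>. range \<rho> \<subseteq> A \<longrightarrow> eval_poly3 scale prd \<rho> p = 0)"

text \<open>
  HOL cannot quantify over types inside a formula, so ``every associative triple system'' ranges
  over the subspaces of vector spaces on \<open>nat \<Rightarrow>\<^sub>0 'k\<close>, a type which carries a
  \<open>'k\<close>-space of countably infinite dimension. Every system of countable dimension is isomorphic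
  to one of these. Nothing is lost: the elements substituted for the three variables generate a
  subsystem of countable dimension, so an identity satisfied in all systems considered here is
  satisfied in every associative triple system over \<open>'k\<close>.
\<close>

definition satisfied_in_all_triple_systems :: "'k::field poly3 \<Rightarrow> bool"
  where "satisfied_in_all_triple_systems p \<longleftrightarrow>
    (\<forall>(scale :: 'k \<Rightarrow> (nat \<Rightarrow>\<^sub>0 'k) \<Rightarrow> (nat \<Rightarrow>\<^sub>0 'k)) A prd.
      assoc_triple_system scale A prd \<longrightarrow> satisfied_in scale A prd p)"

abbreviation comm :: "var \<Rightarrow> var \<Rightarrow> var \<Rightarrow> 'k::field poly3"
  where "comm u v w \<equiv> Poly_Mapping.single (Comm u v w) 1"

abbreviation transl :: "var \<Rightarrow> var \<Rightarrow> var \<Rightarrow> 'k::field poly3"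
  where "transl u v w \<equiv> Poly_Mapping.single (Transl u v w) 1"

text \<open>A polynomial \<open>p\<close> stands for the identity \<open>p = 0\<close>.\<close>

definition defining_identities :: "'k::field poly3 set"
  where "defining_identities =
    {comm X Y Z + comm Y X Z,
     transl X Y Z + transl Y Z X + transl Z X Y,
     (comm X Y Z + comm Z Y X) - (transl X Y Z + transl Z Y X)}"

end

theory Submission
  imports Defs
begin

text \<open>
  Why the theorem is true. Substituting the definitions of the two operations into a multilinear
  polynomial turns it into a combination of the six words \<open>uvw\<close>, where \<open>(u, v, w)\<close> runs over the
  orderings of the three variables. If \<open>c\<^sub>u\<^sub>v\<^sub>w\<close> and \<open>t\<^sub>u\<^sub>v\<^sub>w\<close> denote the coefficients of \<open>[u,v,w]\<close> and
  \<open>\<langle>u,v,w\<rangle>\<close>, the word \<open>uvw\<close> receives \<open>c\<^sub>u\<^sub>v\<^sub>w - c\<^sub>v\<^sub>u\<^sub>w + t\<^sub>u\<^sub>v\<^sub>w - t\<^sub>w\<^sub>u\<^sub>v\<close>.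

  These six coefficients must all vanish, because for each word there is an associative triple
  system which sees that word only: on a space with basis \<open>e\<^sub>0, e\<^sub>1, \<dots>\<close>, multiply the
  \<open>e\<^sub>i\<close>-, \<open>e\<^sub>j\<close>- and \<open>e\<^sub>k\<close>-coordinates of the three factors and put the result at \<open>e\<^sub>n\<close>, where
  \<open>n\<close> is none of \<open>i, j, k\<close>. Every product is then annihilated by further multiplication, so the
  two associativity laws hold trivially (\<open>word_system\<close>, \<open>word_coefficient_vanishes\<close>).

  The six equations sum to zero and otherwise are independent, so the identities form a space of
  dimension \<open>12 - 5 = 7\<close>. The given identities produce 3, 2 and 3 polynomials by permuting the
  variables. These eight have one relation, since the three permuted forms of the last one add up
  to a combination of the others. Leaving out one of these three, the other seven form a basis;
  the coordinates of \<open>p\<close> in it can be read off from the coefficients of \<open>p\<close>, and the six equations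
  say that the expansion is correct.
\<close>

section \<open>Triple systems that detect a single word\<close>

definition pscale :: "'k::field \<Rightarrow> ('a \<Rightarrow>\<^sub>0 'k) \<Rightarrow> ('a \<Rightarrow>\<^sub>0 'k)"
  where "pscale c p = Poly_Mapping.map (\<lambda>a. c * a) p"

lemma lookup_pscale [simp]: "Poly_Mapping.lookup (pscale c p) m = c * Poly_Mapping.lookup p m"
  by (simp add: pscale_def map.rep_eq when_def)

lemma vector_space_pscale: "vector_space pscale"
  by unfold_locales
    (auto simp: poly_mapping_eq_iff fun_eq_iff lookup_add algebra_simps)

definition word_product ::
  "nat \<Rightarrow> nat \<Rightarrow> nat \<Rightarrow> nat \<Rightarrow> (nat \<Rightarrow>\<^sub>0 'k::field) \<Rightarrow> (nat \<Rightarrow>\<^sub>0 'k) \<Rightarrow> (nat \<Rightarrow>\<^sub>0 'k) \<Rightarrow> (nat \<Rightarrow>\<^sub>0 'k)"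
  where "word_product n i j k x y z =
    Poly_Mapping.single n
      (Poly_Mapping.lookup x i * Poly_Mapping.lookup y j * Poly_Mapping.lookup z k)"

text \<open>
  Since \<open>n\<close> differs from \<open>i\<close>, \<open>j\<close> and \<open>k\<close>, a product has zero coordinates in all places that
  the multiplication reads, so both sides of each associativity law are zero.
\<close>

lemma word_system:
  assumes "n \<notin> {i, j, k}"
  shows "assoc_triple_system pscale UNIV
    (word_product n i j k :: (nat \<Rightarrow>\<^sub>0 'k::field) \<Rightarrow> (nat \<Rightarrow>\<^sub>0 'k) \<Rightarrow> (nat \<Rightarrow>\<^sub>0 'k) \<Rightarrow> (nat \<Rightarrow>\<^sub>0 'k))"
proof -
  interpret vector_space "pscale :: 'k \<Rightarrow> (nat \<Rightarrow>\<^sub>0 'k) \<Rightarrow> (nat \<Rightarrow>\<^sub>0 'k)"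
    by (rule vector_space_pscale)
  show ?thesis
    using assms
    by unfold_locales
      (auto simp: subspace_UNIV word_product_def poly_mapping_eq_iff fun_eq_iff
         lookup_single lookup_add when_def algebra_simps)
qed

fun var_index :: "var \<Rightarrow> nat" where
  "var_index X = 0"
| "var_index Y = 1"
| "var_index Z = 2"

lemma var_index_eq_iff [simp]: "var_index u = var_index v \<longleftrightarrow> u = v"
  by (cases u; cases v) auto

lemma var_index_neq_3 [simp]: "var_index u \<noteq> 3" "3 \<noteq> var_index u"
  by (cases u; simp)+

text \<open>
  The assignment sends each variable to its own basis vector, so the product of three variables
  has coordinate 1 at position 3 if these variables spell the chosen word, and 0 otherwise.
\<close>

lemma lookup_word_product_basis:
  "Poly_Mapping.lookup
     (word_product 3 (var_index u) (var_index v) (var_index w)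
        (Poly_Mapping.single (var_index a) 1)
        (Poly_Mapping.single (var_index b) 1)
        (Poly_Mapping.single (var_index c) (1::'k::field))) 3
   = of_bool ((a, b, c) = (u, v, w))"
  by (auto simp: word_product_def lookup_single when_def)

section \<open>The linear equations satisfied by the coefficients of an identity\<close>

definition multilinear_monoms :: "var monom3 set"
  where "multilinear_monoms =
    {Comm X Y Z, Comm Y Z X, Comm Z X Y, Comm Y X Z, Comm X Z Y, Comm Z Y X,
     Transl X Y Z, Transl Y Z X, Transl Z X Y, Transl Y X Z, Transl X Z Y, Transl Z Y X}"

lemma multilinear_monom_iff: "multilinear_monom m \<longleftrightarrow> m \<in> multilinear_monoms"
proof (cases m)
  case (Comm u v w)
  then show ?thesis
    by (cases u; cases v; cases w) (simp_all add: multilinear_monoms_def)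
next
  case (Transl u v w)
  then show ?thesis
    by (cases u; cases v; cases w) (simp_all add: multilinear_monoms_def)
qed

lemma word_coefficient_vanishes:
  fixes p :: "'k::field poly3"
  assumes "multilinear p" "satisfied_in_all_triple_systems p" "distinct [u, v, w]"
  shows "Poly_Mapping.lookup p (Comm u v w) - Poly_Mapping.lookup p (Comm v u w)
    + Poly_Mapping.lookup p (Transl u v w) - Poly_Mapping.lookup p (Transl w u v) = 0"
proof -
  define prd :: "(nat \<Rightarrow>\<^sub>0 'k) \<Rightarrow> (nat \<Rightarrow>\<^sub>0 'k) \<Rightarrow> (nat \<Rightarrow>\<^sub>0 'k) \<Rightarrow> (nat \<Rightarrow>\<^sub>0 'k)"
    where "prd = word_product 3 (var_index u) (var_index v) (var_index w)"
  define \<rho> :: "var \<Rightarrow> (nat \<Rightarrow>\<^sub>0 'k)" where "\<rho> x = Poly_Mapping.single (var_index x) 1" for x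
  have "assoc_triple_system pscale UNIV prd"
    unfolding prd_def by (rule word_system) simp
  then have zero: "eval_poly3 pscale prd \<rho> p = 0"
    using assms(2) unfolding satisfied_in_all_triple_systems_def satisfied_in_def by blast
  have comm: "Poly_Mapping.lookup (eval_monom3 prd \<rho> (Comm a b c)) 3
      = of_bool ((a, b, c) = (u, v, w)) - of_bool ((b, a, c) = (u, v, w))" for a b c
    by (simp only: eval_monom3.simps special_commutator_def lookup_minus prd_def \<rho>_def
          lookup_word_product_basis)
  have transl: "Poly_Mapping.lookup (eval_monom3 prd \<rho> (Transl a b c)) 3
      = of_bool ((a, b, c) = (u, v, w)) - of_bool ((b, c, a) = (u, v, w))" for a b c
    by (simp only: eval_monom3.simps special_translator_def lookup_minus prd_def \<rho>_def
          lookup_word_product_basis)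
  have "0 = Poly_Mapping.lookup (eval_poly3 pscale prd \<rho> p) 3"
    by (simp add: zero)
  also have "\<dots> = (\<Sum>m \<in> Poly_Mapping.keys p.
      Poly_Mapping.lookup p m * Poly_Mapping.lookup (eval_monom3 prd \<rho> m) 3)"
    by (simp add: eval_poly3_def lookup_sum)
  also have "\<dots> = (\<Sum>m \<in> multilinear_monoms.
      Poly_Mapping.lookup p m * Poly_Mapping.lookup (eval_monom3 prd \<rho> m) 3)"
    using assms(1)
    by (intro sum.mono_neutral_left)
      (auto simp: multilinear_def multilinear_monom_iff in_keys_iff, simp add: multilinear_monoms_def)
  also have "\<dots> = Poly_Mapping.lookup p (Comm u v w) - Poly_Mapping.lookup p (Comm v u w)
    + Poly_Mapping.lookup p (Transl u v w) - Poly_Mapping.lookup p (Transl w u v)"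
    using assms(3)
    by (cases u; cases v; cases w)
      (simp_all add: multilinear_monoms_def comm transl del: eval_monom3.simps)
  finally show ?thesis by simp
qed

section \<open>The permuted forms of the defining identities\<close>

lemma permute_vars_superset:
  assumes "finite S" "Poly_Mapping.keys p \<subseteq> S"
  shows "permute_vars \<sigma> p =
    (\<Sum>m \<in> S. Poly_Mapping.single (map_monom3 \<sigma> m) (Poly_Mapping.lookup p m))"
  unfolding permute_vars_def using assms
  by (intro sum.mono_neutral_left) (auto simp: in_keys_iff)

lemma permute_vars_add: "permute_vars \<sigma> (p + q) = permute_vars \<sigma> p + permute_vars \<sigma> q"
proof -
  let ?S = "Poly_Mapping.keys p \<union> Poly_Mapping.keys q"
  have "Poly_Mapping.keys (p + q) \<subseteq> ?S" by (rule Poly_Mapping.keys_add)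
  then show ?thesis
    by (simp add: permute_vars_superset[of ?S] lookup_add single_add sum.distrib)
qed

lemma permute_vars_diff: "permute_vars \<sigma> (p - q) = permute_vars \<sigma> p - permute_vars \<sigma> q"
  using permute_vars_add[of \<sigma> "p - q" q] by simp

lemma permute_vars_single:
  "permute_vars \<sigma> (Poly_Mapping.single m a) = Poly_Mapping.single (map_monom3 \<sigma> m) a"
  by (simp add: permute_vars_def)

definition consequences :: "'k::field poly3 set"
  where "consequences =
    module.span scale_poly3 {permute_vars \<sigma> q | \<sigma> q. bij \<sigma> \<and> q \<in> defining_identities}"

text \<open>Any three distinct variables are the images of \<open>X, Y, Z\<close> under a permutation.\<close>

lemma permuted_identities_are_consequences:
  assumes "distinct [u, v, w]"
  shows "(comm u v w + comm v u w :: 'k::field poly3) \<in> consequences"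
    and "(transl u v w + transl v w u + transl w u v :: 'k poly3) \<in> consequences"
    and "((comm u v w + comm w v u) - (transl u v w + transl w v u) :: 'k poly3) \<in> consequences"
proof -
  define \<sigma> where "\<sigma> x = (case x of X \<Rightarrow> u | Y \<Rightarrow> v | Z \<Rightarrow> w)" for x
  have "inj \<sigma>"
    using assms by (auto simp: inj_def \<sigma>_def split: var.splits)
  moreover have "surj \<sigma>"
  proof -
    have "t \<in> {\<sigma> X, \<sigma> Y, \<sigma> Z}" for t
      using assms by (cases t; cases u; cases v; cases w) (auto simp: \<sigma>_def)
    then show ?thesis by blast
  qed
  ultimately have "bij \<sigma>" by (rule bijI)
  interpret vector_space "scale_poly3 :: 'k \<Rightarrow> 'k poly3 \<Rightarrow> 'k poly3"
    by (rule vector_space_scale_poly3)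
  have mem: "permute_vars \<sigma> q \<in> consequences" if "q \<in> defining_identities" for q :: "'k poly3"
    unfolding consequences_def using \<open>bij \<sigma>\<close> that by (intro span_base) blast
  note expand = defining_identities_def permute_vars_add permute_vars_diff permute_vars_single \<sigma>_def
  show "(comm u v w + comm v u w :: 'k poly3) \<in> consequences"
    using mem[of "comm X Y Z + comm Y X Z"] by (simp add: expand)
  show "(transl u v w + transl v w u + transl w u v :: 'k poly3) \<in> consequences"
    using mem[of "transl X Y Z + transl Y Z X + transl Z X Y"] by (simp add: expand)
  show "((comm u v w + comm w v u) - (transl u v w + transl w v u) :: 'k poly3) \<in> consequences"
    using mem[of "(comm X Y Z + comm Z Y X) - (transl X Y Z + transl Z Y X)"]
    by (simp add: expand)
qed

section \<open>Expansion of an identity in seven permuted forms\<close>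

theorem lemma4p1:
  fixes p :: "'k::field_char_0 poly3"
  assumes "multilinear p"
    and "satisfied_in_all_triple_systems p"
  shows "follows_from p defining_identities"
proof -
  let ?c = "\<lambda>u v w. Poly_Mapping.lookup p (Comm u v w)"
  let ?t = "\<lambda>u v w. Poly_Mapping.lookup p (Transl u v w)"
  let ?skew = "\<lambda>u v w. comm u v w + comm v u w :: 'k poly3"
  let ?cyclic = "\<lambda>u v w. transl u v w + transl v w u + transl w u v :: 'k poly3"
  let ?mixed = "\<lambda>u v w. (comm u v w + comm w v u) - (transl u v w + transl w v u) :: 'k poly3"
  interpret vector_space "scale_poly3 :: 'k \<Rightarrow> 'k poly3 \<Rightarrow> 'k poly3"
    by (rule vector_space_scale_poly3)
  note eq = word_coefficient_vanishes[OF assms]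
  \<comment> \<open>Adding the equations for two words that differ by swapping the first two letters cancels the
    coefficients of the commutators.\<close>
  have transl_eq: "?t u v w + ?t v u w = ?t w u v + ?t w v u" if "distinct [u, v, w]" for u v w
  proof -
    have "?c u v w - ?c v u w + ?t u v w - ?t w u v
        + (?c v u w - ?c u v w + ?t v u w - ?t w v u) = 0"
      using eq[of u v w] eq[of v u w] that by auto
    then show ?thesis by (simp add: algebra_simps)
  qed
  \<comment> \<open>Without \<open>?mixed Z X Y\<close>, only one of the seven polynomials contains \<open>\<langle>Z,X,Y\<rangle>\<close>, and the same
    holds for \<open>\<langle>Y,X,Z\<rangle>\<close>, \<open>[Y,X,Z]\<close> and \<open>[Z,X,Y]\<close>. This gives the coefficients of both \<open>?cyclic\<close> forms
    and of \<open>?skew X Y Z\<close> and \<open>?skew Z X Y\<close>. Comparing \<open>\<langle>X,Y,Z\<rangle>\<close>, \<open>\<langle>Y,Z,X\<rangle>\<close> and finally \<open>[Y,Z,X]\<close>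
    determines the remaining three; the equations for the words take care of the other monomials.\<close>
  have "p =
      scale_poly3 (?c Y X Z) (?skew X Y Z)
    + scale_poly3 (?c Y Z X + ?t Y Z X - ?t Z X Y) (?skew Y Z X)
    + scale_poly3 (?c Z X Y) (?skew Z X Y)
    + scale_poly3 (?t Z X Y) (?cyclic X Y Z)
    + scale_poly3 (?t Y X Z) (?cyclic Y X Z)
    + scale_poly3 (?t Z X Y - ?t X Y Z) (?mixed X Y Z)
    + scale_poly3 (?t Z X Y - ?t Y Z X) (?mixed Y Z X)" (is "p = ?r")
  proof (rule poly_mapping_eqI)
    fix m
    show "Poly_Mapping.lookup p m = Poly_Mapping.lookup ?r m"
    proof (cases "m \<in> multilinear_monoms")
      case True
      then show ?thesis
        using eq[of X Y Z] eq[of Y Z X] eq[of Z X Y] eq[of Y X Z] eq[of X Z Y] eq[of Z Y X]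
          transl_eq[of Z X Y] transl_eq[of X Y Z]
        by (auto simp: multilinear_monoms_def lookup_scale_poly3 lookup_add lookup_minus
              lookup_single algebra_simps)
    next
      case False
      then have "Poly_Mapping.lookup p m = 0"
        using assms(1) by (auto simp: multilinear_def multilinear_monom_iff in_keys_iff)
      then show ?thesis
        using False
        by (auto simp: multilinear_monoms_def lookup_scale_poly3 lookup_add lookup_minus
              lookup_single)
    qed
  qed
  also have "\<dots> \<in> consequences"
    unfolding consequences_def
    by (intro span_add span_scale permuted_identities_are_consequences[unfolded consequences_def])
      simp_all
  finally show ?thesis
    by (simp add: follows_from_def consequences_def)
qed

end
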